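(* For every multi-index $I=(\alpha_1,\dots,\alpha_{4n-1})\in\mathbb N^{4n-1}$ there is a constant $C>0$ (depending only on $n$ and $I$) such that for all $g\in\mathscr H^{n-1}\setminus\{0\}$, $$\left|Y^I K((1,0),g)\right|\le \frac{C}{(\|g\|+1)^{Q+d(I)}},$$ where $Q=4n+2$ and $Y^I$ acts on the variable $g$.
   Context: Let $n\ge2$. $\mathbb H$ denotes the quaternions. The quaternionic Heisenberg group $\mathscr H^{n-1}$ is $\mathbb R^{4n-1}=\mathbb R^3\times\mathbb R^{4n-4}$ with the product $(\bm t,\bm y)\cdot(\bm t',\bm y')=(\bm t+\bm t'+B(\bm y,\bm y'),\bm y+\bm y')$, $B=(B_1,B_2,B_3)$, $B_\alpha(\bm y,\bm y')=2\sum_{l=0}^{n-2}\sum_{j,k=1}^4 b^\alpha_{kj}y_{4l+k}y'_{4l+j}$, where $b^1=\begin{pmatrix}0&1&0&0\\-1&0&0&0\\0&0&0&-1\\0&0&1&0\end{pmatrix}$, $b^2=\begin{pmatrix}0&0&1&0\\0&0&0&1\\-1&0&0&0\\0&-1&0&0\end{pmatrix}$, $b^3=\begin{pmatrix}0&0&0&1\\0&0&-1&0\\0&1&0&0\\-1&0&0&0\end{pmatrix}$. The homogeneous norm is $\|(\bm t,\bm y)\|=(|\bm y|^4+|\bm t|^2)^{1/4}$ and $Q=4n+2$ is the homogeneous dimension. Left-invariant vector fields: $Y_{4l+j}=\partial_{y_{4l+j}}+2\sum_{\alpha=1}^3\sum_{k=1}^4 b^\alpha_{kj}y_{4l+k}\partial_{t_\alpha}$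 ($l=0,\dots,n-2$, $j=1,\dots,4$) and $Y_{4n-4+\alpha}=\partial_{t_\alpha}$ ($\alpha=1,2,3$). For $I=(\alpha_1,\dots,\alpha_{4n-1})\in\mathbb N^{4n-1}$, $Y^I=Y_1^{\alpha_1}\cdots Y_{4n-1}^{\alpha_{4n-1}}$ and $d(I)=\sum_{j=1}^{4n-4}\alpha_j+2\sum_{k=4n-3}^{4n-1}\alpha_k$. Cauchy--Szegő kernel: for $\sigma=x_1+x_2\mathbf i+x_3\mathbf j+x_4\mathbf k\in\mathbb H\setminus\{0\}$ put $s(\sigma)=c_{n-1}\dfrac{\partial^{2(n-1)}}{\partial x_1^{2(n-1)}}\dfrac{\overline\sigma}{|\sigma|^4}$, where $c_{n-1}$ is a nonzero real constant depending only on $n$, and $S(q,p)=s\big(q_1+\overline p_1-2\sum_{k=2}^n\overline p_kq_k\big)$ for $q,p\in\mathbb H^n$. Identify $\bm t\in\mathbb R^3$ with $t_1\mathbf i+t_2\mathbf j+t_3\mathbf k$ and $\mathbb R^{4n-4}$ with $\mathbb H^{n-1}$ (each consecutive block of four real coordinates $y_{4l+1},\dots,y_{4l+4}$ being the quaternion $y_{4l+1}+y_{4l+2}\mathbf i+y_{4l+3}\mathbf j+y_{4l+4}\mathbf k$). For $t>0$, $g=(\bm t,\bm x)$, $g'=(\bm s,\bm y)\in\mathscr H^{n-1}$, define $K((t,g),g')=S\big((t+|\bm x|^2+\bm t,\bm x),(|\bm y|^2+\bm s,\bm y)\big)$. In particular $K((1,0),(\bm t,\bm y))=s(1+|\bm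 y|^2-\bm t)$. *)

theory Defs
  imports "HOL-Analysis.Analysis"
begin

section \<open>Quaternions\<close>

text \<open>\<open>Quat x1 x2 x3 x4\<close> is \<open>x1 + x2 i + x3 j + x4 k\<close>.\<close>

datatype quat = Quat (Qre: real) (Qi: real) (Qj: real) (Qk: real)

lemma quat_eq_iff:
  "p = q \<longleftrightarrow> Qre p = Qre q \<and> Qi p = Qi q \<and> Qj p = Qj q \<and> Qk p = Qk q"
  by (cases p; cases q) simp

instantiation quat :: ring_1
begin

definition zero_quat where "0 = Quat 0 0 0 0"

definition one_quat where "1 = Quat 1 0 0 0"

definition plus_quat where
  "p + q = Quat (Qre p + Qre q) (Qi p + Qi q) (Qj p + Qj q) (Qk p + Qk q)"

definition minus_quat where
  "p - q = Quat (Qre p - Qre q) (Qi p - Qi q) (Qj p - Qj q) (Qk p - Qk q)"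

definition uminus_quat where
  "- p = Quat (- Qre p) (- Qi p) (- Qj p) (- Qk p)"

definition times_quat where
  "p * q = Quat
     (Qre p * Qre q - Qi p * Qi q - Qj p * Qj q - Qk p * Qk q)
     (Qre p * Qi q + Qi p * Qre q + Qj p * Qk q - Qk p * Qj q)
     (Qre p * Qj q - Qi p * Qk q + Qj p * Qre q + Qk p * Qi q)
     (Qre p * Qk q + Qi p * Qj q - Qj p * Qi q + Qk p * Qre q)"

instance
  by standard
    (simp_all add: zero_quat_def one_quat_def plus_quat_def minus_quat_def uminus_quat_def
      times_quat_def quat_eq_iff algebra_simps)

end

instantiation quat :: real_algebra_1
begin

definition scaleR_quat where
  "r *\<^sub>R q = Quat (r * Qre q) (r * Qi q) (r * Qj q) (r * Qk q)"

instance
  by standard (simp_all add: plus_quat_def times_quat_def scaleR_quat_def quat_eq_iff algebra_simps)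

end

instantiation quat :: real_inner
begin

definition inner_quat where
  "inner p q = Qre p * Qre q + Qi p * Qi q + Qj p * Qj q + Qk p * Qk q"

definition norm_quat where "norm (q::quat) = sqrt (inner q q)"

definition sgn_quat where "sgn (q::quat) = q /\<^sub>R norm q"

definition dist_quat where "dist (p::quat) q = norm (p - q)"

definition uniformity_quat where
  "(uniformity :: (quat \<times> quat) filter) = (INF e\<in>{0 <..}. principal {(x, y). dist x y < e})"

definition open_quat where
  "open (U :: quat set) \<longleftrightarrow>
    (\<forall>x\<in>U. eventually (\<lambda>(x', y). x' = x \<longrightarrow> y \<in> U) uniformity)"

instance
proof
  fix x :: quat
  show "0 \<le> inner x x"
    by (simp add: inner_quat_def)
  show "inner x x = 0 \<longleftrightarrow> x = 0"
  proof
    assume "inner x x = 0"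
    then have "Qre x ^ 2 + Qi x ^ 2 + Qj x ^ 2 + Qk x ^ 2 = 0"
      by (simp add: inner_quat_def power2_eq_square)
    moreover have "0 \<le> Qre x ^ 2" "0 \<le> Qi x ^ 2" "0 \<le> Qj x ^ 2" "0 \<le> Qk x ^ 2"
      by simp_all
    ultimately have "Qre x ^ 2 = 0" "Qi x ^ 2 = 0" "Qj x ^ 2 = 0" "Qk x ^ 2 = 0"
      by linarith+
    then show "x = 0"
      by (simp add: quat_eq_iff zero_quat_def)
  qed (simp add: inner_quat_def zero_quat_def)
qed (simp_all add: inner_quat_def norm_quat_def sgn_quat_def dist_quat_def uniformity_quat_def
      open_quat_def plus_quat_def scaleR_quat_def algebra_simps)

end

definition qcnj :: "quat \<Rightarrow> quat" where
  "qcnj q = Quat (Qre q) (- Qi q) (- Qj q) (- Qk q)"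


section \<open>The quaternionic Heisenberg group\<close>

text \<open>
  A point is a pair \<open>(t, y)\<close>. The coordinates of \<open>y\<close> in \<open>\<real>\<^bsup>4n-4\<^esup>\<close> are numbered \<open>1..4n-4\<close>, as
  an argument of a function on \<open>nat\<close> that vanishes at all other arguments; the set of points for
  a given \<open>n\<close> is \<open>heis n\<close>.
\<close>

type_synonym heis = "(real ^ 3) \<times> (nat \<Rightarrow> real)"

definition heis :: "nat \<Rightarrow> heis set" where
  "heis n = {(t, y). \<forall>i. i \<notin> {1..4*n-4} \<longrightarrow> y i = 0}"

definition heis_zero :: heis where
  "heis_zero = (0, \<lambda>_. 0)"

text \<open>
  The entry in row \<open>k\<close> and column \<open>j\<close> of \<open>b\<close> with upper index \<open>\<alpha>\<close> is \<open>bmat \<alpha> $ k $ j\<close>. A natural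
  number \<open>k\<close> in \<open>1..4\<close> is sent to the index type \<open>4\<close> (in which \<open>4 = 0\<close>) by \<open>of_nat\<close>.
\<close>

definition bmat :: "3 \<Rightarrow> real ^ 4 ^ 4" where
  "bmat \<alpha> =
    (if \<alpha> = 1 then
       vector [vector [ 0, 1, 0, 0], vector [-1, 0, 0, 0], vector [0, 0, 0,-1], vector [0, 0, 1, 0]]
     else if \<alpha> = 2 then
       vector [vector [ 0, 0, 1, 0], vector [ 0, 0, 0, 1], vector [-1, 0, 0, 0], vector [0,-1, 0, 0]]
     else
       vector [vector [ 0, 0, 0, 1], vector [ 0, 0,-1, 0], vector [ 0, 1, 0, 0], vector [-1, 0, 0, 0]])"

definition Bform :: "nat \<Rightarrow> (nat \<Rightarrow> real) \<Rightarrow> (nat \<Rightarrow> real) \<Rightarrow> real ^ 3" where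
  "Bform n y y' = (\<chi> \<alpha>. 2 * (\<Sum>l=0..n-2. \<Sum>j=1..4. \<Sum>k=1..4.
     bmat \<alpha> $ of_nat k $ of_nat j * y (4*l+k) * y' (4*l+j)))"

definition heis_mult :: "nat \<Rightarrow> heis \<Rightarrow> heis \<Rightarrow> heis" where
  "heis_mult n = (\<lambda>(t, y) (t', y'). (t + t' + Bform n y y', \<lambda>i. y i + y' i))"

definition ynorm :: "nat \<Rightarrow> (nat \<Rightarrow> real) \<Rightarrow> real" where
  "ynorm n y = L2_set y {1..4*n-4}"

definition heis_norm :: "nat \<Rightarrow> heis \<Rightarrow> real" where
  "heis_norm n = (\<lambda>(t, y). root 4 (ynorm n y ^ 4 + norm t ^ 2))"

definition hom_dim :: "nat \<Rightarrow> nat" where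
  "hom_dim n = 4*n + 2"


section \<open>Left-invariant vector fields\<close>

definition dt :: "3 \<Rightarrow> (heis \<Rightarrow> quat) \<Rightarrow> heis \<Rightarrow> quat" where
  "dt \<alpha> f = (\<lambda>(t, y). vector_derivative (\<lambda>h. f (t + h *\<^sub>R axis \<alpha> 1, y)) (at 0))"

definition dy :: "nat \<Rightarrow> (heis \<Rightarrow> quat) \<Rightarrow> heis \<Rightarrow> quat" where
  "dy i f = (\<lambda>(t, y). vector_derivative (\<lambda>h. f (t, y(i := y i + h))) (at 0))"

definition Yhor :: "nat \<Rightarrow> nat \<Rightarrow> (heis \<Rightarrow> quat) \<Rightarrow> heis \<Rightarrow> quat" where
  "Yhor l j f = (\<lambda>(t, y). dy (4*l+j) f (t, y) +
     2 * (\<Sum>\<alpha>\<in>UNIV. \<Sum>k=1..4. (bmat \<alpha> $ of_nat k $ of_nat j * y (4*l+k)) *\<^sub>R dt \<alpha> f (t, y)))"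

text \<open>
  \<open>Yfield n i\<close> is \<open>Y\<^sub>i\<close> for \<open>1 \<le> i \<le> 4n-1\<close>. An index \<open>i \<le> 4n-4\<close> is written \<open>4l+j\<close> with
  \<open>1 \<le> j \<le> 4\<close>.
\<close>

definition Yfield :: "nat \<Rightarrow> nat \<Rightarrow> (heis \<Rightarrow> quat) \<Rightarrow> heis \<Rightarrow> quat" where
  "Yfield n i =
    (if i \<le> 4*n-4 then Yhor ((i-1) div 4) ((i-1) mod 4 + 1) else dt (of_nat (i - (4*n-4))))"

text \<open>
  A multi-index is a function on \<open>nat\<close>, of which only the values at \<open>1..4n-1\<close> are used. In
  \<open>Ypow n I\<close> the operator with the largest index is applied first.
\<close>

definition Ypow :: "nat \<Rightarrow> (nat \<Rightarrow> nat) \<Rightarrow> (heis \<Rightarrow> quat) \<Rightarrow> heis \<Rightarrow> quat" where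
  "Ypow n I f = foldr (\<lambda>i. Yfield n i ^^ I i) [1..<4*n] f"

definition hom_deg :: "nat \<Rightarrow> (nat \<Rightarrow> nat) \<Rightarrow> nat" where
  "hom_deg n I = (\<Sum>j=1..4*n-4. I j) + 2 * (\<Sum>k=4*n-3..4*n-1. I k)"


section \<open>The Cauchy-Szego kernel\<close>

definition dx1 :: "(quat \<Rightarrow> quat) \<Rightarrow> quat \<Rightarrow> quat" where
  "dx1 f \<sigma> = vector_derivative (\<lambda>h. f (\<sigma> + of_real h)) (at 0)"

text \<open>
  The constants \<open>c\<^bsub>n-1\<^esub>\<close> are a parameter. Points of \<open>\<bbbH>\<^sup>n\<close> are functions on \<open>nat\<close>, of which only
  the values at \<open>1..n\<close> are used.
\<close>

definition cs_s :: "(nat \<Rightarrow> real) \<Rightarrow> nat \<Rightarrow> quat \<Rightarrow> quat" where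
  "cs_s c n \<sigma> = c (n-1) *\<^sub>R (dx1 ^^ (2*(n-1))) (\<lambda>\<sigma>. qcnj \<sigma> /\<^sub>R norm \<sigma> ^ 4) \<sigma>"

definition cs_S :: "(nat \<Rightarrow> real) \<Rightarrow> nat \<Rightarrow> (nat \<Rightarrow> quat) \<Rightarrow> (nat \<Rightarrow> quat) \<Rightarrow> quat" where
  "cs_S c n q p = cs_s c n (q 1 + qcnj (p 1) - 2 * (\<Sum>k=2..n. qcnj (p k) * q k))"

definition im_quat :: "real ^ 3 \<Rightarrow> quat" where
  "im_quat t = Quat 0 (t $ 1) (t $ 2) (t $ 3)"

definition qblock :: "(nat \<Rightarrow> real) \<Rightarrow> nat \<Rightarrow> quat" where
  "qblock y l = Quat (y (4*l+1)) (y (4*l+2)) (y (4*l+3)) (y (4*l+4))"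

text \<open>
  \<open>siegel n t (\<tau>, y)\<close> is the point \<open>(t + \<bar>y\<bar>\<^sup>2 + \<tau>, y)\<close> of \<open>\<bbbH>\<^sup>n\<close>; the blocks \<open>l = 0..n-2\<close> of \<open>y\<close> are
  its components \<open>2..n\<close>.
\<close>

definition siegel :: "nat \<Rightarrow> real \<Rightarrow> heis \<Rightarrow> nat \<Rightarrow> quat" where
  "siegel n t = (\<lambda>(\<tau>, y) k.
    if k = 1 then of_real (t + ynorm n y ^ 2) + im_quat \<tau> else qblock y (k - 2))"

definition cs_K :: "(nat \<Rightarrow> real) \<Rightarrow> nat \<Rightarrow> real \<times> heis \<Rightarrow> heis \<Rightarrow> quat" where
  "cs_K c n = (\<lambda>(t, g) g'. cs_S c n (siegel n t g) (siegel n 0 g'))"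

end

theory Submission
  imports Defs
begin

text \<open>
  Put \<open>w = 1 + \<bar>y\<bar>\<^sup>2\<close> and \<open>N = w\<^sup>2 + \<bar>t\<bar>\<^sup>2\<close>, so that \<open>K ((1, 0), (t, y)) = s (w - t)\<close> and
  \<open>\<bar>w - t\<bar>\<^sup>2 = N\<close>. Give \<open>w\<close>, \<open>t\<^sub>\<alpha>\<close>, \<open>y\<^sub>i\<close>, \<open>1 / N\<close> the orders \<open>-2, -2, -1, 4\<close>. The components of
  the kernel are polynomials in these generators, homogeneous of order \<open>Q\<close>; each horizontal
  field raises the order by \<open>1\<close> and each \<open>\<partial>\<^bsub>t\<^esub>\<close> raises it by \<open>2\<close>. A polynomial of order \<open>d\<close> is
  \<open>O(N\<^bsup>-d/4\<^esup>)\<close>, and \<open>\<parallel>g\<parallel> + 1 \<le> 2 N\<^bsup>1/4\<^esup>\<close>.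
\<close>

section \<open>Homogeneous polynomials in graded generators\<close>

text \<open>The order is attached to functions, not to formal expressions, so relations between the
  generators do no harm. Zero has every order: differentiation shifts the order by a fixed amount
  even where the derivative vanishes.\<close>

inductive graded :: "(int \<times> ('a \<Rightarrow> real)) set \<Rightarrow> int \<Rightarrow> ('a \<Rightarrow> real) \<Rightarrow> bool" for G where
  gen: "(d, f) \<in> G \<Longrightarrow> graded G d f"
| const: "graded G 0 (\<lambda>_. a)"
| zero: "graded G d (\<lambda>_. 0)"
| add: "graded G d f \<Longrightarrow> graded G d g \<Longrightarrow> graded G d (\<lambda>x. f x + g x)"
| mult: "graded G d f \<Longrightarrow> graded G e g \<Longrightarrow> graded G (d + e) (\<lambda>x. f x * g x)"

lemma graded_cmult:
  assumes "graded G d f"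
  shows "graded G d (\<lambda>x. a * f x)"
  using graded.mult[OF graded.const assms, of a] by simp

lemma graded_uminus:
  assumes "graded G d f"
  shows "graded G d (\<lambda>x. - f x)"
  using graded_cmult[OF assms, of "-1"] by simp

lemma graded_mult':
  assumes "graded G d f" "graded G e g" "k = d + e"
  shows "graded G k (\<lambda>x. f x * g x)"
  using graded.mult[OF assms(1,2)] assms(3) by simp

lemma graded_sum:
  assumes "\<And>i. i \<in> A \<Longrightarrow> graded G d (f i)"
  shows "graded G d (\<lambda>x. \<Sum>i\<in>A. f i x)"
  using assms by (induction A rule: infinite_finite_induct) (simp_all add: graded.zero graded.add)

text \<open>By the sum and product rules it is enough to know the generators. The curve
  \<open>\<gamma> x\<close> starts at \<open>x\<close>, and one homogeneous function gives the
  derivative at all points of \<open>S\<close>: the half-space for \<open>quat_gens\<close>, the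
  whole space for \<open>heis_gens\<close>.\<close>

lemma graded_derivative:
  fixes \<gamma> :: "'a \<Rightarrow> real \<Rightarrow> 'a"
  assumes "graded G d f"
    and gen: "\<And>d f. (d, f) \<in> G \<Longrightarrow>
      \<exists>g. graded G (d + e) g \<and> (\<forall>x\<in>S. ((\<lambda>h. f (\<gamma> x h)) has_real_derivative g x) (at 0))"
    and \<gamma>: "\<And>x. \<gamma> x 0 = x"
  shows "\<exists>g. graded G (d + e) g \<and> (\<forall>x\<in>S. ((\<lambda>h. f (\<gamma> x h)) has_real_derivative g x) (at 0))"
  using assms(1)
proof induction
  case (gen d f)
  then show ?case by (rule assms(2))
next
  case (const a)
  show ?case
    by (rule exI[of _ "\<lambda>_. 0"]) (simp add: graded.zero)
next
  case (zero d)
  show ?case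
    by (rule exI[of _ "\<lambda>_. 0"]) (simp add: graded.zero)
next
  case (add d f g)
  then obtain f' g' where
    "graded G (d + e) f'" "graded G (d + e) g'"
    "\<And>x. x \<in> S \<Longrightarrow> ((\<lambda>h. f (\<gamma> x h)) has_real_derivative f' x) (at 0)"
    "\<And>x. x \<in> S \<Longrightarrow> ((\<lambda>h. g (\<gamma> x h)) has_real_derivative g' x) (at 0)"
    by blast
  then show ?case
    by (intro exI[of _ "\<lambda>x. f' x + g' x"] conjI ballI graded.add DERIV_add) auto
next
  case (mult d f k g)
  then obtain f' g' where *:
    "graded G (d + e) f'" "graded G (k + e) g'"
    "\<And>x. x \<in> S \<Longrightarrow> ((\<lambda>h. f (\<gamma> x h)) has_real_derivative f' x) (at 0)"
    "\<And>x. x \<in> S \<Longrightarrow> ((\<lambda>h. g (\<gamma> x h)) has_real_derivative g' x) (at 0)"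
    by blast
  have "graded G (d + k + e) (\<lambda>x. f' x * g x + g' x * f x)"
    by (intro graded.add graded_mult'[OF *(1) mult.hyps(2)] graded_mult'[OF *(2) mult.hyps(1)]) auto
  moreover have "((\<lambda>h. f (\<gamma> x h) * g (\<gamma> x h)) has_real_derivative f' x * g x + g' x * f x) (at 0)"
    if "x \<in> S" for x
    using DERIV_mult[OF *(3)[OF that] *(4)[OF that]] by (simp add: \<gamma>)
  ultimately show ?case by blast
qed

text \<open>Substitution is compatible with sums and products. The factor \<open>m\<close> rescales
  the grading; it is 2 below, since quaternions of Euclidean degree 1 become functions of Heisenberg
  degree 2.\<close>

lemma graded_comp:
  fixes m :: int
  assumes "graded G d f"
    and "\<And>d f. (d, f) \<in> G \<Longrightarrow> graded H (m * d) (\<lambda>x. f (\<phi> x))"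
  shows "graded H (m * d) (\<lambda>x. f (\<phi> x))"
  using assms(1)
  by induction (auto simp: distrib_left intro: assms(2) graded.intros)

text \<open>Bounds by powers of one gauge \<open>\<rho>\<close> multiply as the orders add, so only
  the generators need an estimate.\<close>

lemma graded_bound:
  assumes "graded G d f"
    and gen: "\<And>d f. (d, f) \<in> G \<Longrightarrow> \<exists>C. \<forall>x. \<bar>f x\<bar> \<le> C * \<rho> x powr - of_int d"
    and \<rho>: "\<And>x. \<rho> x > 0"
  shows "\<exists>C. \<forall>x. \<bar>f x\<bar> \<le> C * \<rho> x powr - of_int d"
  using assms(1)
proof induction
  case (gen d f)
  then show ?case by (rule assms(2))
next
  case (const a)
  \<comment> \<open>Positivity matters even for order 0, because
    \<open>0 powr 0 = 0\<close>.\<close>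
  show ?case using \<rho> by (intro exI[of _ "\<bar>a\<bar>"]) (simp add: less_imp_neq[symmetric])
next
  case (zero d)
  show ?case by (intro exI[of _ 0]) simp
next
  case (add d f g)
  then obtain A B where *: "\<And>x. \<bar>f x\<bar> \<le> A * \<rho> x powr - of_int d"
    "\<And>x. \<bar>g x\<bar> \<le> B * \<rho> x powr - of_int d"
    by blast
  have "\<bar>f x + g x\<bar> \<le> (A + B) * \<rho> x powr - of_int d" for x
    using *[of x] by (simp add: distrib_right)
  then show ?case by blast
next
  case (mult d f e g)
  then obtain A B where *: "\<And>x. \<bar>f x\<bar> \<le> A * \<rho> x powr - of_int d"
    "\<And>x. \<bar>g x\<bar> \<le> B * \<rho> x powr - of_int e"
    by blast
  have "\<bar>f x * g x\<bar> \<le> (A * B) * \<rho> x powr - of_int (d + e)" for x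
  proof -
    \<comment> \<open>Each factor on the right dominates an absolute value and is therefore
      nonnegative, as monotonicity of the product demands.\<close>
    have "\<bar>f x * g x\<bar> \<le> (A * \<rho> x powr - of_int d) * (B * \<rho> x powr - of_int e)"
      unfolding abs_mult using *[of x] by (intro mult_mono) (auto intro: order_trans[OF abs_ge_zero])
    also have "\<dots> = (A * B) * \<rho> x powr - of_int (d + e)"
      by (simp add: algebra_simps flip: powr_add)
    finally show ?thesis .
  qed
  then show ?case by blast
qed


section \<open>Quaternion-valued functions\<close>

lemma quat_sel [simp]:
  "Qre (p + q) = Qre p + Qre q" "Qi (p + q) = Qi p + Qi q"
  "Qj (p + q) = Qj p + Qj q" "Qk (p + q) = Qk p + Qk q"
  "Qre (p - q) = Qre p - Qre q" "Qi (p - q) = Qi p - Qi q"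
  "Qj (p - q) = Qj p - Qj q" "Qk (p - q) = Qk p - Qk q"
  "Qre (r *\<^sub>R q) = r * Qre q" "Qi (r *\<^sub>R q) = r * Qi q"
  "Qj (r *\<^sub>R q) = r * Qj q" "Qk (r *\<^sub>R q) = r * Qk q"
  "Qre 0 = 0" "Qi 0 = 0" "Qj 0 = 0" "Qk 0 = 0"
  "Qre 1 = 1" "Qi 1 = 0" "Qj 1 = 0" "Qk 1 = 0"
  "Qre (qcnj q) = Qre q" "Qi (qcnj q) = - Qi q"
  "Qj (qcnj q) = - Qj q" "Qk (qcnj q) = - Qk q"
  by (simp_all add: plus_quat_def minus_quat_def scaleR_quat_def zero_quat_def one_quat_def
      qcnj_def)

lemma quat_of_real_sel [simp]:
  "Qre (of_real r) = r" "Qi (of_real r) = 0" "Qj (of_real r) = 0" "Qk (of_real r) = 0"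
  by (simp_all add: of_real_def)

lemma norm_quat_sq:
  "norm (q :: quat) ^ 2 = Qre q ^ 2 + Qi q ^ 2 + Qj q ^ 2 + Qk q ^ 2"
  unfolding power2_norm_eq_inner by (simp add: inner_quat_def power2_eq_square)

lemma norm_quat_le: "norm (q :: quat) \<le> \<bar>Qre q\<bar> + \<bar>Qi q\<bar> + \<bar>Qj q\<bar> + \<bar>Qk q\<bar>"
proof (rule power2_le_imp_le)
  show "norm q ^ 2 \<le> (\<bar>Qre q\<bar> + \<bar>Qi q\<bar> + \<bar>Qj q\<bar> + \<bar>Qk q\<bar>) ^ 2"
    unfolding norm_quat_sq by (simp add: power2_eq_square algebra_simps)
qed simp

text \<open>Every quaternion is a real combination of the fixed units 1, i, j, k, and the
  coefficients are differentiated one by one.\<close>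

lemma has_vector_derivative_quat:
  assumes "((\<lambda>h. Qre (F h)) has_real_derivative Qre D) (at x)"
    and "((\<lambda>h. Qi (F h)) has_real_derivative Qi D) (at x)"
    and "((\<lambda>h. Qj (F h)) has_real_derivative Qj D) (at x)"
    and "((\<lambda>h. Qk (F h)) has_real_derivative Qk D) (at x)"
  shows "(F has_vector_derivative D) (at x)"
proof -
  have expand: "q = Qre q *\<^sub>R Quat 1 0 0 0 + Qi q *\<^sub>R Quat 0 1 0 0
      + Qj q *\<^sub>R Quat 0 0 1 0 + Qk q *\<^sub>R Quat 0 0 0 1" for q
    by (simp add: quat_eq_iff)
  have scale: "((\<lambda>h. f h *\<^sub>R u) has_vector_derivative f' *\<^sub>R u) (at x)"
    if "(f has_real_derivative f') (at x)" for f f' and u :: quat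
    using has_vector_derivative_scaleR[OF that has_vector_derivative_const, of u] by simp
  have "((\<lambda>h. Qre (F h) *\<^sub>R Quat 1 0 0 0 + Qi (F h) *\<^sub>R Quat 0 1 0 0
      + Qj (F h) *\<^sub>R Quat 0 0 1 0 + Qk (F h) *\<^sub>R Quat 0 0 0 1) has_vector_derivative
      (Qre D *\<^sub>R Quat 1 0 0 0 + Qi D *\<^sub>R Quat 0 1 0 0
      + Qj D *\<^sub>R Quat 0 0 1 0 + Qk D *\<^sub>R Quat 0 0 0 1)) (at x)"
    by (intro has_vector_derivative_add scale assms)
  then show ?thesis
    by (simp only: expand[symmetric])
qed

definition qgraded :: "(int \<times> ('a \<Rightarrow> real)) set \<Rightarrow> int \<Rightarrow> ('a \<Rightarrow> quat) \<Rightarrow> bool" where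
  "qgraded G d F \<longleftrightarrow> graded G d (\<lambda>x. Qre (F x)) \<and> graded G d (\<lambda>x. Qi (F x)) \<and>
     graded G d (\<lambda>x. Qj (F x)) \<and> graded G d (\<lambda>x. Qk (F x))"

lemma qgraded_zero: "qgraded G d (\<lambda>_. 0)"
  by (simp add: qgraded_def graded.zero)

lemma qgraded_add:
  assumes "qgraded G d F" "qgraded G d H"
  shows "qgraded G d (\<lambda>x. F x + H x)"
  using assms by (simp add: qgraded_def graded.add)

lemma qgraded_sum:
  assumes "\<And>i. i \<in> A \<Longrightarrow> qgraded G d (F i)"
  shows "qgraded G d (\<lambda>x. \<Sum>i\<in>A. F i x)"
  using assms by (induction A rule: infinite_finite_induct) (simp_all add: qgraded_zero qgraded_add)

lemma qgraded_scaleR: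
  assumes "graded G d f" "qgraded G e F" "k = d + e"
  shows "qgraded G k (\<lambda>x. f x *\<^sub>R F x)"
  using assms by (simp add: qgraded_def graded.mult)

lemma qgraded_cscaleR:
  assumes "qgraded G d F"
  shows "qgraded G d (\<lambda>x. a *\<^sub>R F x)"
  by (rule qgraded_scaleR[OF graded.const assms]) simp

lemma qgraded_derivative:
  fixes \<gamma> :: "'a \<Rightarrow> real \<Rightarrow> 'a"
  assumes "qgraded G d F"
    and gen: "\<And>d f. (d, f) \<in> G \<Longrightarrow>
      \<exists>g. graded G (d + e) g \<and> (\<forall>x\<in>S. ((\<lambda>h. f (\<gamma> x h)) has_real_derivative g x) (at 0))"
    and \<gamma>: "\<And>x. \<gamma> x 0 = x"
  shows "\<exists>H. qgraded G (d + e) H \<and>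
    (\<forall>x\<in>S. ((\<lambda>h. F (\<gamma> x h)) has_vector_derivative H x) (at 0))"
proof -
  have derivative: "\<exists>g. graded G (d + e) g \<and>
      (\<forall>x\<in>S. ((\<lambda>h. f (\<gamma> x h)) has_real_derivative g x) (at 0))" if "graded G d f" for f
    using that gen \<gamma> by (rule graded_derivative)
  have
    "graded G d (\<lambda>x. Qre (F x))" "graded G d (\<lambda>x. Qi (F x))"
    "graded G d (\<lambda>x. Qj (F x))" "graded G d (\<lambda>x. Qk (F x))"
    using assms(1) by (simp_all add: qgraded_def)
  from this[THEN derivative] obtain f1 f2 f3 f4 where
    "graded G (d + e) f1" "graded G (d + e) f2" "graded G (d + e) f3" "graded G (d + e) f4"
    "\<forall>x\<in>S. ((\<lambda>h. Qre (F (\<gamma> x h))) has_real_derivative f1 x) (at 0)"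
    "\<forall>x\<in>S. ((\<lambda>h. Qi (F (\<gamma> x h))) has_real_derivative f2 x) (at 0)"
    "\<forall>x\<in>S. ((\<lambda>h. Qj (F (\<gamma> x h))) has_real_derivative f3 x) (at 0)"
    "\<forall>x\<in>S. ((\<lambda>h. Qk (F (\<gamma> x h))) has_real_derivative f4 x) (at 0)"
    by (elim exE conjE) (rule that)
  then show ?thesis
    by (intro exI[of _ "\<lambda>x. Quat (f1 x) (f2 x) (f3 x) (f4 x)"] conjI ballI
        has_vector_derivative_quat) (auto simp: qgraded_def)
qed


section \<open>The Cauchy-Szego kernel on a half-space\<close>

text \<open>The order is minus the Euclidean degree of homogeneity.\<close>

definition quat_gens :: "(int \<times> (quat \<Rightarrow> real)) set" where
  "quat_gens = {(-1, Qre), (-1, Qi), (-1, Qj), (-1, Qk), (2, \<lambda>\<sigma>. inverse (norm \<sigma> ^ 2))}"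

lemma quat_gens_graded:
  "graded quat_gens (-1) Qre" "graded quat_gens (-1) Qi" "graded quat_gens (-1) Qj"
  "graded quat_gens (-1) Qk" "graded quat_gens 2 (\<lambda>\<sigma>. inverse (norm \<sigma> ^ 2))"
  by (rule graded.gen; simp add: quat_gens_def)+

text \<open>The only nontrivial case is the derivative \<open>-2 x1 / |\<sigma>|^4\<close> of
  \<open>1 / |\<sigma>|^2\<close>, of order -1 + 4 = 2 + 1. A positive real part keeps
  \<open>\<sigma>\<close> away from the singularity at 0.\<close>

lemma quat_gens_derivative:
  assumes "(d, f) \<in> quat_gens"
  shows "\<exists>g. graded quat_gens (d + 1) g \<and>
    (\<forall>\<sigma>\<in>{\<sigma>. Qre \<sigma> > 0}. ((\<lambda>h. f (\<sigma> + of_real h)) has_real_derivative g \<sigma>) (at 0))"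
proof -
  have *: "graded quat_gens 3
      (\<lambda>\<sigma>. (-2) * (Qre \<sigma> * (inverse (norm \<sigma> ^ 2) * inverse (norm \<sigma> ^ 2))))"
    by (rule graded_cmult graded_mult' quat_gens_graded)+ auto
  have **: "((\<lambda>h. inverse (norm (\<sigma> + of_real h) ^ 2)) has_real_derivative
      (-2) * (Qre \<sigma> * (inverse (norm \<sigma> ^ 2) * inverse (norm \<sigma> ^ 2)))) (at 0)"
    if "Qre \<sigma> > 0" for \<sigma>
  proof -
    have pos: "Qre \<sigma> ^ 2 + Qi \<sigma> ^ 2 + Qj \<sigma> ^ 2 + Qk \<sigma> ^ 2 > 0"
      using that by (intro add_pos_nonneg) auto
    show ?thesis
      unfolding norm_quat_sq
      by (auto intro!: derivative_eq_intros simp: pos[THEN less_imp_neq, symmetric])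
  qed
  have "f = Qre \<Longrightarrow> d = -1 \<Longrightarrow> ?thesis"
    by (rule exI[of _ "\<lambda>_. 1"]) (auto simp: graded.const intro!: derivative_eq_intros)
  moreover have "f \<in> {Qi, Qj, Qk} \<Longrightarrow> ?thesis"
    by (rule exI[of _ "\<lambda>_. 0"]) (auto simp: graded.zero)
  moreover have "f = (\<lambda>\<sigma>. inverse (norm \<sigma> ^ 2)) \<Longrightarrow> d = 2 \<Longrightarrow> ?thesis"
    using * ** by (intro exI conjI) auto
  ultimately show ?thesis
    using assms unfolding quat_gens_def by blast
qed

text \<open>The half-space is open, so small real shifts of \<open>\<sigma>\<close> stay inside it.
  This allows \<open>dx1\<close> to be iterated although the earlier derivatives are identified only
  there.\<close>

lemma dx1_cong_halfspace:
  assumes "\<And>\<sigma>. Qre \<sigma> > 0 \<Longrightarrow> F \<sigma> = H \<sigma>" "Qre \<sigma> > 0"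
    and "((\<lambda>h. H (\<sigma> + of_real h)) has_vector_derivative D) (at 0)"
  shows "dx1 F \<sigma> = D"
proof -
  have "((\<lambda>h. F (\<sigma> + of_real h)) has_vector_derivative D) (at 0)"
    using assms(3)
    \<comment> \<open>The set consists of the shifts \<open>h\<close> that leave the real part
      positive.\<close>
    by (rule has_vector_derivative_transform_within_open[where S = "{- Qre \<sigma><..}"])
      (use assms(1,2) in auto)
  then show ?thesis
    unfolding dx1_def by (rule vector_derivative_at)
qed

text \<open>The starting function has components \<open>\<plusminus>x_i / |\<sigma>|^4\<close>, of
  order 4 - 1 = 3, and each derivative adds 1.\<close>

lemma dx1_iterate_graded:
  "\<exists>H. qgraded quat_gens (3 + int k) H \<and>
    (\<forall>\<sigma>. Qre \<sigma> > 0 \<longrightarrow> (dx1 ^^ k) (\<lambda>\<sigma>. qcnj \<sigma> /\<^sub>R norm \<sigma> ^ 4) \<sigma> = H \<sigma>)"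
proof (induction k)
  case 0
  have *: "graded quat_gens 3 (\<lambda>\<sigma>. (inverse (norm \<sigma> ^ 2) * inverse (norm \<sigma> ^ 2)) * f \<sigma>)"
    if "graded quat_gens (-1) f" for f
    by (rule graded_mult'[OF graded_mult'[OF quat_gens_graded(5) quat_gens_graded(5) refl] that])
      simp
  have inv: "inverse (norm \<sigma> ^ 4) = inverse (norm \<sigma> ^ 2) * inverse (norm \<sigma> ^ 2)" for \<sigma> :: quat
    by (simp flip: inverse_mult_distrib power_add)
  have "qgraded quat_gens 3 (\<lambda>\<sigma>. qcnj \<sigma> /\<^sub>R norm \<sigma> ^ 4)"
    unfolding qgraded_def quat_sel inv
    by (intro conjI * graded_uminus quat_gens_graded)
  then show ?case
    by auto
next
  case (Suc k)
  then obtain H where H: "qgraded quat_gens (3 + int k) H"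
    "\<And>\<sigma>. Qre \<sigma> > 0 \<Longrightarrow> (dx1 ^^ k) (\<lambda>\<sigma>. qcnj \<sigma> /\<^sub>R norm \<sigma> ^ 4) \<sigma> = H \<sigma>"
    by blast
  obtain H' where "qgraded quat_gens (3 + int k + 1) H'"
    "\<forall>\<sigma>\<in>{\<sigma>. Qre \<sigma> > 0}. ((\<lambda>h. H (\<sigma> + of_real h)) has_vector_derivative H' \<sigma>) (at 0)"
    using qgraded_derivative[where \<gamma> = "\<lambda>\<sigma> h. \<sigma> + of_real h", OF H(1) quat_gens_derivative]
    by auto
  then show ?case
    using dx1_cong_halfspace[OF H(2)] by (intro exI[of _ H']) (auto simp: algebra_simps)
qed


section \<open>Homogeneous functions on the Heisenberg group\<close>

definition heis_w :: "nat \<Rightarrow> heis \<Rightarrow> real" where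
  "heis_w n = (\<lambda>(t, y). 1 + ynorm n y ^ 2)"

definition heis_N :: "nat \<Rightarrow> heis \<Rightarrow> real" where
  "heis_N n = (\<lambda>(t, y). (1 + ynorm n y ^ 2) ^ 2 + norm t ^ 2)"

text \<open>The gauge \<open>N^(1/4)\<close>. It is comparable to 1 plus the homogeneous
  norm.\<close>

definition heis_rho :: "nat \<Rightarrow> heis \<Rightarrow> real" where
  "heis_rho n g = sqrt (sqrt (heis_N n g))"

text \<open>\<open>w\<close> is a generator of its own: as a polynomial in \<open>y\<close> it would
  mix the orders 0 and -2.\<close>

definition heis_gens :: "nat \<Rightarrow> (int \<times> (heis \<Rightarrow> real)) set" where
  "heis_gens n = {(-2, heis_w n)} \<union> range (\<lambda>\<alpha>. (-2, \<lambda>g. fst g $ \<alpha>)) \<union>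
     (\<lambda>i. (-1, \<lambda>g. snd g i)) ` {1..4*n-4} \<union> {(4, \<lambda>g. inverse (heis_N n g))}"

lemma heis_gens_graded:
  "graded (heis_gens n) (-2) (heis_w n)"
  "graded (heis_gens n) (-2) (\<lambda>g. fst g $ \<alpha>)"
  "i \<in> {1..4*n-4} \<Longrightarrow> graded (heis_gens n) (-1) (\<lambda>g. snd g i)"
  "graded (heis_gens n) 4 (\<lambda>g. inverse (heis_N n g))"
  by (rule graded.gen; simp add: heis_gens_def)+

lemma heis_gens_cases:
  assumes "(d, f) \<in> heis_gens n"
  obtains "d = -2" "f = heis_w n"
  | \<alpha> where "d = -2" "f = (\<lambda>g. fst g $ \<alpha>)"
  | i where "i \<in> {1..4*n-4}" "d = -1" "f = (\<lambda>g. snd g i)"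
  | "d = 4" "f = (\<lambda>g. inverse (heis_N n g))"
  using assms unfolding heis_gens_def by blast

lemma heis_w_eq: "heis_w n g = 1 + ynorm n (snd g) ^ 2"
  by (simp add: heis_w_def split: prod.splits)

lemma heis_w_ge: "heis_w n g \<ge> 1"
  by (simp add: heis_w_eq)

lemma heis_N_eq: "heis_N n g = heis_w n g ^ 2 + norm (fst g) ^ 2"
  by (simp add: heis_N_def heis_w_def split: prod.splits)

lemma heis_N_ge: "heis_N n g \<ge> 1"
  unfolding heis_N_eq using one_le_power[OF heis_w_ge] by (simp add: add_increasing2)

lemma ynorm_sq: "ynorm n y ^ 2 = (\<Sum>i=1..4*n-4. y i ^ 2)"
  by (simp add: ynorm_def L2_set_def sum_nonneg)

section \<open>Derivatives of the generators along coordinate lines\<close>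

lemma ynorm_upd:
  assumes "i \<in> {1..4*n-4}"
  shows "ynorm n (y(i := y i + h)) ^ 2 = ynorm n y ^ 2 + 2 * h * y i + h ^ 2"
  using assms
  by (simp add: ynorm_sq sum.remove[of _ i] power2_sum algebra_simps)

lemma norm_axis_shift:
  fixes t :: "real ^ 3"
  shows "norm (t + h *\<^sub>R axis \<alpha> 1) ^ 2 = norm t ^ 2 + 2 * h * t $ \<alpha> + h ^ 2"
  unfolding power2_norm_eq_inner
  by (simp add: inner_add_left inner_add_right inner_axis inner_commute[of "axis \<alpha> 1"]
      power2_eq_square algebra_simps)

text \<open>The shift by 8 is the order of \<open>1 / N^2\<close> in the chain rule for
  \<open>1 / N\<close>.\<close>

lemma graded_inverse_heis_N:
  assumes "graded (heis_gens n) k D" "l = k + 8"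
  shows "graded (heis_gens n) l (\<lambda>g. - (D g * (inverse (heis_N n g) * inverse (heis_N n g))))"
  by (rule graded_uminus graded_mult' heis_gens_graded assms)+ (use assms in auto)

lemma inverse_heis_N_derivative:
  assumes "((\<lambda>h. heis_N n (\<gamma> h)) has_real_derivative D) (at 0)" "\<gamma> 0 = g"
  shows "((\<lambda>h. inverse (heis_N n (\<gamma> h))) has_real_derivative
    - (D * (inverse (heis_N n g) * inverse (heis_N n g)))) (at 0)"
  using DERIV_inverse'[OF assms(1)] heis_N_ge[of n g] assms(2) by (simp add: mult_ac)

text \<open>\<open>w\<close> and \<open>y\<close> are constant along the line, and \<open>t\<close>
  has constant derivatives, of order 0. As \<open>N\<close> has derivative
  \<open>2 t_\<alpha>\<close>, of order -2, that of \<open>1 / N\<close> has order -2 + 8 = 4 +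
  2.\<close>

lemma heis_gens_dt:
  assumes "(d, f) \<in> heis_gens n"
  shows "\<exists>f'. graded (heis_gens n) (d + 2) f' \<and>
    (\<forall>g\<in>UNIV. ((\<lambda>h. f (fst g + h *\<^sub>R axis \<alpha> 1, snd g)) has_real_derivative f' g) (at 0))"
  using assms
proof (cases rule: heis_gens_cases)
  case 1
  then show ?thesis
    by (intro exI[of _ "\<lambda>_. 0"]) (simp add: graded.zero heis_w_def)
next
  case (2 \<beta>)
  then show ?thesis
    by (intro exI[of _ "\<lambda>_. axis \<alpha> 1 $ \<beta>"])
      (auto simp: graded.const intro!: derivative_eq_intros)
next
  case (3 i)
  then show ?thesis
    by (intro exI[of _ "\<lambda>_. 0"]) (simp add: graded.zero)
next
  case 4
  have *: "((\<lambda>h. heis_N n (fst g + h *\<^sub>R axis \<alpha> 1, snd g)) has_real_derivative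
      2 * fst g $ \<alpha>) (at 0)" for g :: heis
    by (auto simp: heis_N_def norm_axis_shift intro!: derivative_eq_intros)
  have "graded (heis_gens n) (-2) (\<lambda>g. 2 * fst g $ \<alpha>)"
    by (intro graded_cmult heis_gens_graded)
  then have "graded (heis_gens n) 6
      (\<lambda>g. - ((2 * fst g $ \<alpha>) * (inverse (heis_N n g) * inverse (heis_N n g))))"
    by (rule graded_inverse_heis_N) simp
  with inverse_heis_N_derivative[OF *] 4 show ?thesis
    by (intro exI conjI ballI) auto
qed

text \<open>\<open>w\<close> has derivative \<open>2 y_i\<close>, of order -1. \<open>N\<close> has
  derivative \<open>4 w y_i\<close>, of order -3, so that of \<open>1 / N\<close> has order -3 + 8 =
  4 + 1.\<close>

lemma heis_gens_dy:
  assumes "(d, f) \<in> heis_gens n" and i: "i \<in> {1..4*n-4}"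
  shows "\<exists>f'. graded (heis_gens n) (d + 1) f' \<and>
    (\<forall>g\<in>UNIV. ((\<lambda>h. f (fst g, (snd g)(i := snd g i + h))) has_real_derivative f' g) (at 0))"
  using assms(1)
proof (cases rule: heis_gens_cases)
  case 1
  have "graded (heis_gens n) (-1) (\<lambda>g. 2 * snd g i)"
    by (intro graded_cmult heis_gens_graded i)
  with 1 show ?thesis
    by (intro exI[of _ "\<lambda>g. 2 * snd g i"])
      (auto simp: heis_w_def ynorm_upd[OF i] intro!: derivative_eq_intros)
next
  case (2 \<beta>)
  then show ?thesis
    by (intro exI[of _ "\<lambda>_. 0"]) (simp add: graded.zero)
next
  case (3 j)
  have "((\<lambda>h. ((snd g)(i := snd g i + h)) j) has_real_derivative (if i = j then 1 else 0)) (at 0)"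
    for g :: heis
    by (auto intro!: derivative_eq_intros)
  with 3 show ?thesis
    by (intro exI[of _ "\<lambda>_. if i = j then 1 else 0"]) (auto simp: graded.const)
next
  case 4
  have *: "((\<lambda>h. heis_N n (fst g, (snd g)(i := snd g i + h))) has_real_derivative
      4 * (heis_w n g * snd g i)) (at 0)" for g
    by (auto simp: heis_N_def heis_w_def ynorm_upd[OF i] split: prod.splits
        intro!: derivative_eq_intros)
  have "graded (heis_gens n) (-3) (\<lambda>g. 4 * (heis_w n g * snd g i))"
    by (rule graded_cmult graded_mult' heis_gens_graded i)+ simp
  then have "graded (heis_gens n) 5
      (\<lambda>g. - ((4 * (heis_w n g * snd g i)) * (inverse (heis_N n g) * inverse (heis_N n g))))"
    by (rule graded_inverse_heis_N) simp
  with inverse_heis_N_derivative[OF *] 4 show ?thesis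
    by (intro exI conjI ballI) auto
qed

section \<open>Action of the left-invariant fields\<close>

lemma qgraded_dt:
  assumes "qgraded (heis_gens n) d F"
  shows "qgraded (heis_gens n) (d + 2) (dt \<alpha> F)"
proof -
  obtain H where H: "qgraded (heis_gens n) (d + 2) H" "\<And>g.
    ((\<lambda>h. F (fst g + h *\<^sub>R axis \<alpha> 1, snd g)) has_vector_derivative H g) (at 0)"
    using qgraded_derivative[where \<gamma> = "\<lambda>g h. (fst g + h *\<^sub>R axis \<alpha> 1, snd g)",
        OF assms heis_gens_dt] by auto
  \<comment> \<open>\<open>N\<close> is at least 1, so the derivative exists at every point and the
    identity is one of functions; the fields can then be iterated directly.\<close>
  have "dt \<alpha> F = H"
    using vector_derivative_at[OF H(2)] by (auto simp: dt_def fun_eq_iff)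
  with H(1) show ?thesis by simp
qed

lemma qgraded_dy:
  assumes "qgraded (heis_gens n) d F" and i: "i \<in> {1..4*n-4}"
  shows "qgraded (heis_gens n) (d + 1) (dy i F)"
proof -
  obtain H where H: "qgraded (heis_gens n) (d + 1) H" "\<And>g.
    ((\<lambda>h. F (fst g, (snd g)(i := snd g i + h))) has_vector_derivative H g) (at 0)"
    using qgraded_derivative[where \<gamma> = "\<lambda>g h. (fst g, (snd g)(i := snd g i + h))",
        OF assms(1) heis_gens_dy[OF _ i]] by auto
  have "dy i F = H"
    using vector_derivative_at[OF H(2)] by (auto simp: dy_def fun_eq_iff)
  with H(1) show ?thesis by simp
qed

text \<open>In the vertical terms the coefficient \<open>y_(4l+k)\<close> has order -1 and
  \<open>dt\<close> adds 2, so they match the shift by 1 of \<open>dy\<close>. The bound on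
  \<open>l\<close> keeps the index \<open>4l+k\<close> within \<open>1..4n-4\<close>.\<close>

lemma qgraded_Yhor:
  assumes F: "qgraded (heis_gens n) d F" and "l < n - 1" "j \<in> {1..4}"
  shows "qgraded (heis_gens n) (d + 1) (Yhor l j F)"
proof -
  have "qgraded (heis_gens n) (d + 1)
      (\<lambda>g. (bmat \<alpha> $ of_nat k $ of_nat j * snd g (4*l+k)) *\<^sub>R dt \<alpha> F g)"
    if "k \<in> {1..4}" for \<alpha> k
    using assms that
    by (intro qgraded_scaleR[OF _ qgraded_dt[OF F], where d = "-1"] graded_cmult heis_gens_graded)
      auto
  then have "qgraded (heis_gens n) (d + 1) (\<lambda>g. dy (4*l+j) F g + 2 *\<^sub>R (\<Sum>\<alpha>\<in>UNIV. \<Sum>k=1..4.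
      (bmat \<alpha> $ of_nat k $ of_nat j * snd g (4*l+k)) *\<^sub>R dt \<alpha> F g))"
    using assms by (intro qgraded_add qgraded_cscaleR qgraded_sum qgraded_dy[OF F]) auto
  \<comment> \<open>In \<open>Yhor\<close> the factor 2 is a quaternion, here a real scalar; both
    amount to adding the term to itself.\<close>
  also have "(\<lambda>g. dy (4*l+j) F g + 2 *\<^sub>R (\<Sum>\<alpha>\<in>UNIV. \<Sum>k=1..4.
      (bmat \<alpha> $ of_nat k $ of_nat j * snd g (4*l+k)) *\<^sub>R dt \<alpha> F g)) = Yhor l j F"
    by (auto simp: Yhor_def fun_eq_iff scaleR_2 mult_2)
  finally show ?thesis .
qed

definition field_weight :: "nat \<Rightarrow> nat \<Rightarrow> nat" where
  "field_weight n i = (if i \<le> 4*n-4 then 1 else 2)"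

lemma qgraded_Yfield:
  assumes "qgraded (heis_gens n) d F" "i \<ge> 1"
  shows "qgraded (heis_gens n) (d + int (field_weight n i)) (Yfield n i F)"
proof (cases "i \<le> 4*n-4")
  case True
  then have "(i - 1) div 4 < n - 1" "(i - 1) mod 4 + 1 \<in> {1..4}"
    using assms(2) by (auto simp: div_less_iff_less_mult)
  from qgraded_Yhor[OF assms(1) this] True show ?thesis
    by (simp add: Yfield_def field_weight_def)
next
  case False
  with qgraded_dt[OF assms(1)] show ?thesis
    by (simp add: Yfield_def field_weight_def)
qed

lemma qgraded_Yfield_power:
  assumes "qgraded (heis_gens n) d F" "i \<ge> 1"
  shows "qgraded (heis_gens n) (d + int (m * field_weight n i)) ((Yfield n i ^^ m) F)"
proof (induction m)
  case 0
  then show ?case using assms(1) by simp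
next
  case (Suc m)
  then show ?case
    using qgraded_Yfield[OF Suc assms(2)] by (simp add: algebra_simps)
qed

text \<open>This puts \<open>d(I)\<close> in the form of a sum over the list along which
  \<open>Ypow\<close> folds.\<close>

lemma hom_deg_eq:
  assumes "n \<ge> 1"
  shows "hom_deg n I = (\<Sum>i\<leftarrow>[1..<4*n]. I i * field_weight n i)"
proof -
  have split: "{1..<4*n} = {1..4*n-4} \<union> {4*n-3..4*n-1}"
    using assms by auto
  have "(\<Sum>i\<leftarrow>[1..<4*n]. I i * field_weight n i) = (\<Sum>i\<in>{1..<4*n}. I i * field_weight n i)"
    by (simp add: interv_sum_list_conv_sum_set_nat)
  also have "\<dots> = (\<Sum>i=1..4*n-4. I i * field_weight n i) + (\<Sum>i=4*n-3..4*n-1. I i * field_weight n i)"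
    unfolding split using assms by (intro sum.union_disjoint) auto
  also have "(\<Sum>i=1..4*n-4. I i * field_weight n i) = (\<Sum>i=1..4*n-4. I i)"
    by (rule sum.cong) (auto simp: field_weight_def)
  also have "(\<Sum>i=4*n-3..4*n-1. I i * field_weight n i) = (\<Sum>i=4*n-3..4*n-1. 2 * I i)"
    using assms by (intro sum.cong) (auto simp: field_weight_def)
  finally show ?thesis
    by (simp add: hom_deg_def sum_distrib_left)
qed

lemma qgraded_Ypow:
  assumes F: "qgraded (heis_gens n) d F" and "n \<ge> 1"
  shows "qgraded (heis_gens n) (d + int (hom_deg n I)) (Ypow n I F)"
proof -
  \<comment> \<open>The induction needs arbitrary lists of positive indices, since the fold peels
    off the head and applies its power last.\<close>
  have "qgraded (heis_gens n) (d + int (\<Sum>i\<leftarrow>is. I i * field_weight n i))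
      (foldr (\<lambda>i. Yfield n i ^^ I i) is F)" if "\<forall>i\<in>set is. i \<ge> 1" for "is"
    using that
  proof (induction "is")
    case Nil
    then show ?case using F by simp
  next
    case (Cons i "is")
    then show ?case
      using qgraded_Yfield_power[where i = i and m = "I i", OF Cons.IH]
      by (simp add: algebra_simps)
  qed
  then show ?thesis
    unfolding Ypow_def hom_deg_eq[OF assms(2)] by simp
qed


section \<open>The kernel and its size\<close>

text \<open>At the group identity the components \<open>2..n\<close> of the first argument vanish,
  which removes the sum in \<open>cs_S\<close>; conjugating the second argument flips the sign of
  \<open>t\<close>.\<close>

lemma cs_K_eq:
  "cs_K c n (1, heis_zero) g =
    cs_s c n (Quat (heis_w n g) (- fst g $ 1) (- fst g $ 2) (- fst g $ 3))"
proof -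
  have "siegel n 1 heis_zero k = 0" if "k \<in> {2..n}" for k
    using that by (simp add: siegel_def heis_zero_def qblock_def zero_quat_def)
  then have "(\<Sum>k=2..n. qcnj (siegel n 0 g k) * siegel n 1 heis_zero k) = 0"
    by (intro sum.neutral) simp
  moreover have "siegel n 1 heis_zero 1 + qcnj (siegel n 0 g 1) =
      Quat (heis_w n g) (- fst g $ 1) (- fst g $ 2) (- fst g $ 3)"
    by (simp add: siegel_def heis_zero_def heis_w_def im_quat_def quat_eq_iff ynorm_def L2_set_def
        split: prod.splits flip: of_real_power)
  ultimately show ?thesis
    by (simp add: cs_K_def cs_S_def)
qed

text \<open>Under \<open>\<sigma> = w - t\<close> the coordinates get order -2 and
  \<open>1 / |\<sigma>|^2 = 1 / N\<close> gets order 4, twice their orders in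
  \<open>quat_gens\<close>. The order \<open>3 + 2(n-1)\<close> of \<open>s\<close> thus doubles to
  \<open>4n + 2 = Q\<close>.\<close>

lemma qgraded_cs_K:
  assumes "n \<ge> 1"
  shows "qgraded (heis_gens n) (int (hom_dim n)) (cs_K c n (1, heis_zero))"
proof -
  define \<sigma> where "\<sigma> g = Quat (heis_w n g) (- fst g $ 1) (- fst g $ 2) (- fst g $ 3)" for g
  obtain H where H: "qgraded quat_gens (3 + int (2 * (n - 1))) H"
    "\<And>\<sigma>. Qre \<sigma> > 0 \<Longrightarrow> (dx1 ^^ (2 * (n - 1))) (\<lambda>\<sigma>. qcnj \<sigma> /\<^sub>R norm \<sigma> ^ 4) \<sigma> = H \<sigma>"
    using dx1_iterate_graded by blast
  have "norm (\<sigma> g) ^ 2 = heis_N n g" for g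
    by (simp add: \<sigma>_def norm_quat_sq heis_N_eq power2_norm_eq_inner[of "fst g"] inner_vec_def sum_3)
      (simp add: power2_eq_square)
  then have "graded (heis_gens n) 4 (\<lambda>g. inverse (norm (\<sigma> g) ^ 2))"
    by (simp add: heis_gens_graded)
  then have gens: "graded (heis_gens n) (2 * d) (\<lambda>g. f (\<sigma> g))" if "(d, f) \<in> quat_gens" for d f
    using that heis_gens_graded(1,2)[of n]
    by (auto simp: quat_gens_def \<sigma>_def intro!: graded_uminus)
  have deg: "2 * (3 + int (2 * (n - 1))) = int (hom_dim n)"
    using assms by (simp add: hom_dim_def)
  have "qgraded (heis_gens n) (int (hom_dim n)) (\<lambda>g. H (\<sigma> g))"
    using H(1) graded_comp[where \<phi> = \<sigma>, OF _ gens] unfolding qgraded_def deg[symmetric] by blast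
  then have "qgraded (heis_gens n) (int (hom_dim n)) (\<lambda>g. c (n - 1) *\<^sub>R H (\<sigma> g))"
    by (rule qgraded_cscaleR)
  moreover have "cs_K c n (1, heis_zero) = (\<lambda>g. c (n - 1) *\<^sub>R H (\<sigma> g))"
  proof
    fix g
    \<comment> \<open>The real part is \<open>w\<close>, so \<open>\<sigma> g\<close> lies where
      \<open>H\<close> represents the iterated derivative.\<close>
    have "Qre (\<sigma> g) > 0"
      using heis_w_ge[of n g] by (simp add: \<sigma>_def)
    then show "cs_K c n (1, heis_zero) g = c (n - 1) *\<^sub>R H (\<sigma> g)"
      unfolding cs_K_eq \<sigma>_def[symmetric] cs_s_def by (simp only: H(2))
  qed
  ultimately show ?thesis by simp
qed

section \<open>Size estimates in terms of the gauge\<close>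

lemma heis_rho_ge: "heis_rho n g \<ge> 1"
  using heis_N_ge[of n g] by (simp add: heis_rho_def)

lemma heis_rho_sq: "heis_rho n g ^ 2 = sqrt (heis_N n g)"
  using heis_N_ge[of n g] by (simp add: heis_rho_def)

lemma heis_rho_pow4: "heis_rho n g ^ 4 = heis_N n g"
proof -
  have "heis_rho n g ^ 4 = (heis_rho n g ^ 2) ^ 2"
    by (simp flip: power_mult)
  also have "\<dots> = heis_N n g"
    using heis_N_ge[of n g] unfolding heis_rho_sq by simp
  finally show ?thesis .
qed

lemma heis_w_le: "heis_w n g \<le> heis_rho n g ^ 2"
  unfolding heis_rho_sq by (rule real_le_rsqrt) (simp add: heis_N_eq)

text \<open>All constants are 1: \<open>w\<close> and \<open>|t|\<close> are at most
  \<open>sqrt N = rho^2\<close>, \<open>y_i^2 \<le> |y|^2 \<le> w \<le> rho^2\<close>, and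
  \<open>1 / N\<close> equals \<open>rho^(-4)\<close>.\<close>

lemma heis_gens_bound:
  assumes "(d, f) \<in> heis_gens n"
  shows "\<bar>f g\<bar> \<le> heis_rho n g powr - of_int d"
  using assms
proof (cases rule: heis_gens_cases)
  case 1
  then show ?thesis
    using heis_w_le[of n g] heis_w_ge[of n g] heis_rho_ge[of n g] by simp
next
  case (2 \<alpha>)
  have "norm (fst g) \<le> heis_rho n g ^ 2"
    unfolding heis_rho_sq by (rule real_le_rsqrt) (simp add: heis_N_eq)
  with 2 component_le_norm_cart[of "fst g" \<alpha>] heis_rho_ge[of n g] show ?thesis
    by simp
next
  case (3 i)
  have "snd g i ^ 2 \<le> ynorm n (snd g) ^ 2"
    unfolding ynorm_sq using 3 member_le_sum[of i "{1..4*n-4}" "\<lambda>j. snd g j ^ 2"] by simp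
  also have "\<dots> \<le> heis_rho n g ^ 2"
    using heis_w_le[of n g] by (simp add: heis_w_eq)
  finally have "\<bar>snd g i\<bar> \<le> heis_rho n g"
    using heis_rho_ge[of n g] power2_le_imp_le[of "\<bar>snd g i\<bar>" "heis_rho n g"] by simp
  with 3 heis_rho_ge[of n g] show ?thesis
    by simp
next
  case 4
  then show ?thesis
    using heis_rho_ge[of n g] heis_N_ge[of n g]
    by (simp add: powr_minus heis_rho_pow4)
qed

lemma qgraded_bound:
  assumes "qgraded (heis_gens n) (int m) F"
  shows "\<exists>C>0. \<forall>g. norm (F g) \<le> C / heis_rho n g ^ m"
proof -
  have gen: "\<exists>C. \<forall>g. \<bar>f g\<bar> \<le> C * heis_rho n g powr - of_int d"
    if "(d, f) \<in> heis_gens n" for d f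
    using heis_gens_bound[OF that] by (intro exI[of _ 1]) simp
  have pos: "heis_rho n g > 0" for g
    using heis_rho_ge[of n g] by linarith
  have bound: "\<exists>C. \<forall>g. \<bar>f g\<bar> \<le> C * inverse (heis_rho n g ^ m)"
    if "graded (heis_gens n) (int m) f" for f
    using graded_bound[where \<rho> = "heis_rho n", OF that gen pos]
    by (simp add: powr_minus powr_realpow pos)
  obtain A1 A2 A3 A4 where
    "\<And>g. \<bar>Qre (F g)\<bar> \<le> A1 * inverse (heis_rho n g ^ m)"
    "\<And>g. \<bar>Qi (F g)\<bar> \<le> A2 * inverse (heis_rho n g ^ m)"
    "\<And>g. \<bar>Qj (F g)\<bar> \<le> A3 * inverse (heis_rho n g ^ m)"
    "\<And>g. \<bar>Qk (F g)\<bar> \<le> A4 * inverse (heis_rho n g ^ m)"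
    using assms unfolding qgraded_def by (meson bound)
  then have le: "norm (F g) \<le> (A1 + A2 + A3 + A4) * inverse (heis_rho n g ^ m)" for g
    unfolding distrib_right by (intro order_trans[OF norm_quat_le] add_mono)
  \<comment> \<open>The absolute value and the added 1 make the constant strictly positive.\<close>
  have "norm (F g) \<le> (\<bar>A1 + A2 + A3 + A4\<bar> + 1) / heis_rho n g ^ m" for g
    unfolding divide_inverse using pos[of g]
    by (intro order_trans[OF le] mult_right_mono) auto
  then show ?thesis
    by (intro exI[of _ "\<bar>A1 + A2 + A3 + A4\<bar> + 1"]) auto
qed

text \<open>\<open>|y|^4 + |t|^2 \<le> N = rho^4\<close> bounds the homogeneous norm by
  \<open>rho\<close>, and the summand 1 is bounded by \<open>rho\<close> too.\<close>

lemma heis_norm_le: "0 \<le> heis_norm n g" "heis_norm n g + 1 \<le> 2 * heis_rho n g"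
proof -
  obtain t y where g: "g = (t, y)" by (cases g)
  show "0 \<le> heis_norm n g"
    by (simp add: heis_norm_def g)
  have "(ynorm n y ^ 2) ^ 2 \<le> (1 + ynorm n y ^ 2) ^ 2"
    by (intro power_mono) auto
  then have "ynorm n y ^ 4 + norm t ^ 2 \<le> heis_rho n g ^ 4"
    unfolding heis_rho_pow4 by (simp add: heis_N_def g)
  then have "heis_norm n g \<le> root 4 (heis_rho n g ^ 4)"
    by (simp add: heis_norm_def g)
  also have "\<dots> = heis_rho n g"
    using heis_rho_ge[of n g] by (intro real_root_power_cancel) auto
  finally show "heis_norm n g + 1 \<le> 2 * heis_rho n g"
    using heis_rho_ge[of n g] by linarith
qed

theorem theorem1p1:
  fixes n :: nat and c :: "nat \<Rightarrow> real" and I :: "nat \<Rightarrow> nat"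
  assumes "n \<ge> 2" and "c (n - 1) \<noteq> 0"
  shows "\<exists>C>0. \<forall>g \<in> heis n - {heis_zero}.
    norm (Ypow n I (cs_K c n (1, heis_zero)) g) \<le> C / (heis_norm n g + 1) ^ (hom_dim n + hom_deg n I)"
proof -
  define m where "m = hom_dim n + hom_deg n I"
  have "n \<ge> 1"
    using assms(1) by simp
  then have "qgraded (heis_gens n) (int m) (Ypow n I (cs_K c n (1, heis_zero)))"
    using qgraded_Ypow[OF qgraded_cs_K] by (simp add: m_def)
  then obtain C where C: "C > 0"
    "\<And>g. norm (Ypow n I (cs_K c n (1, heis_zero)) g) \<le> C / heis_rho n g ^ m"
    using qgraded_bound by blast
  \<comment> \<open>The factor \<open>2 ^ m\<close> is the price of replacing \<open>rho\<close> by
    half of the homogeneous norm plus 1.\<close>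
  have "C / heis_rho n g ^ m \<le> (2 ^ m * C) / (heis_norm n g + 1) ^ m" for g
  proof -
    have "(heis_norm n g + 1) ^ m \<le> (2 * heis_rho n g) ^ m"
      using heis_norm_le[of n g] by (intro power_mono) auto
    moreover have "(heis_norm n g + 1) ^ m > 0" "heis_rho n g ^ m > 0"
      using heis_norm_le(1)[of n g] heis_rho_ge[of n g] by auto
    ultimately show ?thesis
      using C(1) by (simp add: field_simps power_mult_distrib)
  qed
  then have "norm (Ypow n I (cs_K c n (1, heis_zero)) g) \<le> (2 ^ m * C) / (heis_norm n g + 1) ^ m" for g
    using C(2) order_trans by blast
  with C(1) show ?thesis
    unfolding m_def[symmetric] by (intro exI[of _ "2 ^ m * C"] conjI ballI) simp_all
qed

end
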